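(* Assume the second-order cone (SOC) relaxation of the optimal power flow (OPF) problem is exact. Then the duality gap of the OPF problem is zero, i.e., $p^\star=d^\star$, where $p^\star$ is the optimal value of the OPF problem and $d^\star$ is the optimal value of its Lagrangian dual problem.
   Context: Notation: $\mathbb S^N$ is the set of Hermitian $N\times N$ matrices, $\mathbf X\succeq\mathbf 0$ means positive semidefinite (psd), $\mathbf e_n$ is a standard basis vector, $\mathbb R_+=[0,\infty)$. Grid data. Buses $\mathcal V=\{1,\dots,N_V\}$, AC branches $\mathcal E=\{1,\dots,N_E\}$, DC branches $\mathcal D=\{1,\dots,N_D\}$; maps $\hat\epsilon,\check\epsilon:\mathcal E\to\mathcal V$ give source and destination of AC branches. There are no self-loops ($\hat\epsilon(k)\ne\check\epsilon(k)$), no two AC branches join the same pair of buses, and every bus is an endpoint of at least one AC branch. Let $\mathcal I=\{(i,j)\in\mathcal V\times\mathcal V: i,j\in\{\hat\epsilon(k),\check\epsilon(k)\}\text{ for some }k\in\mathcal E\}$. For each $n\in\mathcal V$ there are given: $\mathbf P_n,\mathbf Q_n\in\mathbb S^{N_V}$ (active/reactive power), $\mathbf h_n\in\mathbb R^{N_D}$, $\mathbf M_n=\mathbf e_n\mathbf e_n^{T}$, voltage bounds $0<\underline V_n\le\bar V_n$, nonempty compact convex sets $\mathcal G_n,\mathcal D_n\subset\mathbb R^2$ (generation, load), a convex cost $C_n:\mathcal G_n\to\mathbb R$ and a concave benefit $B_n:\mathcal D_n\to\mathbb R$. For each $k\in\mathcal E$ there are given matrices in $\mathbb S^{N_V}$: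 current matrices $\hat{\mathbf I}_k,\check{\mathbf I}_k$ with current bounds $\hat J_k,\check J_k\ge0$, voltage drop matrices $\underline{\mathbf M}_k,\bar{\mathbf M}_k$, and angle difference matrices $\mathbf A_k,\underline{\mathbf A}_k,\bar{\mathbf A}_k$. All these Hermitian matrices have zero entries outside $\mathcal I$. DC flow bounds are $\underline{\mathbf p},\bar{\mathbf p}\in\mathbb R^{N_D}$. Let $M=2N_V+7N_E+2N_D$, $\mathcal M=\{1,\dots,M\}$, and let $(\mathbf C_m,\mathbf c_m,b_m)\in\mathbb S^{N_V}\times\mathbb R^{N_D}\times\mathbb R$, $m\in\mathcal M$, enumerate: $(\mathbf M_n,\mathbf 0,\bar V_n^2)$ and $(-\mathbf M_n,\mathbf 0,-\underline V_n^2)$ for $n\in\mathcal V$; $(\hat{\mathbf I}_k,\mathbf 0,\hat J_k^2)$, $(\check{\mathbf I}_k,\mathbf 0,\check J_k^2)$ and $(\mathbf X,\mathbf 0,0)$ with $\mathbf X\in\{\underline{\mathbf M}_k,\bar{\mathbf M}_k,\mathbf A_k,\underline{\mathbf A}_k,\bar{\mathbf A}_k\}$ for $k\in\mathcal E$; $(\mathbf 0,\mathbf e_l,\bar p_l)$ and $(\mathbf 0,-\mathbf e_l,-\underline p_l)$ for $l\in\mathcal D$. Put $\mathbf b=[b_1,\dots,b_M]^T$. For $\mathbf W\in\mathbb S^{N_V}$, $\mathbf p\in\mathbb R^{N_D}$, $\mathbf g_n\in\mathcal G_n$, $\mathbf d_n\in\mathcal D_n$ ($n\in\mathcal V$), consider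 the constraints (PB) $\operatorname{tr}(\mathbf P_n\mathbf W)+\mathbf h_n^T\mathbf p=[\mathbf g_n-\mathbf d_n]_1$ and $\operatorname{tr}(\mathbf Q_n\mathbf W)=[\mathbf g_n-\mathbf d_n]_2$ for all $n\in\mathcal V$; (IN) $\operatorname{tr}(\mathbf C_m\mathbf W)+\mathbf c_m^T\mathbf p\le b_m$ for all $m\in\mathcal M$. The objective (welfare) is $\sum_{n}B_n(\mathbf d_n)-\sum_n C_n(\mathbf g_n)$. OPF problem: maximize the welfare over $\mathbf v\in\mathbb C^{N_V}$, $\mathbf p$, $\mathbf g_n\in\mathcal G_n$, $\mathbf d_n\in\mathcal D_n$ subject to (PB), (IN) with $\mathbf W=\mathbf v\mathbf v^{H}$; optimal value $p^\star$. Standing assumption (strict feasibility): there is an OPF-feasible tuple $(\mathbf v,\mathbf p,(\mathbf g_n),(\mathbf d_n))$ for which all inequalities in (IN) hold strictly and $\mathbf g_n-\mathbf d_n\in\operatorname{int}(\mathcal G_n-\mathcal D_n)$ for all $n$, where $\mathcal G_n-\mathcal D_n=\{\mathbf g-\mathbf d:\mathbf g\in\mathcal G_n,\mathbf d\in\mathcal D_n\}$; moreover all $\mathcal G_n,\mathcal D_n$ are polyhedral. Dual of the OPF problem: for $\boldsymbol\lambda_{\mathcal V}=(\boldsymbol\lambda_n)_{n\in\mathcal V}$, $\boldsymbol\lambda_n\in\mathbb R^2$, and $\boldsymbol\mu\in\mathbb R^M$ let $\Psi(\boldsymbol\lambda_{\mathcal V},\boldsymbol\mu)=\sum_n([\boldsymbol\lambda_n]_1\mathbf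 P_n+[\boldsymbol\lambda_n]_2\mathbf Q_n)+\sum_m[\boldsymbol\mu]_m\mathbf C_m$, $\psi(\boldsymbol\lambda_{\mathcal V},\boldsymbol\mu)=\sum_n[\boldsymbol\lambda_n]_1\mathbf h_n+\sum_m[\boldsymbol\mu]_m\mathbf c_m$, $\sigma_n(\boldsymbol\lambda_n)=\max_{\mathbf d\in\mathcal D_n}\{B_n(\mathbf d)-\boldsymbol\lambda_n^T\mathbf d\}$, $\pi_n(\boldsymbol\lambda_n)=\max_{\mathbf g\in\mathcal G_n}\{\boldsymbol\lambda_n^T\mathbf g-C_n(\mathbf g)\}$ (suprema if not attained). The dual is: minimize $\boldsymbol\mu^T\mathbf b+\sum_n\sigma_n(\boldsymbol\lambda_n)+\sum_n\pi_n(\boldsymbol\lambda_n)$ over $\boldsymbol\lambda_n\in\mathbb R^2$, $\boldsymbol\mu\in\mathbb R_+^M$ subject to $\Psi(\boldsymbol\lambda_{\mathcal V},\boldsymbol\mu)\succeq\mathbf 0$ and $\psi(\boldsymbol\lambda_{\mathcal V},\boldsymbol\mu)=\mathbf 0$; optimal value $d^\star$. SOC relaxation: let $\tilde{\mathbb S}^{N_V}=\{\mathbf V\in\mathbb S^{N_V}:[\mathbf V]_{i,j}=0\ \forall (i,j)\notin\mathcal I\}$, $\mathbf S_k=[\mathbf e_{\hat\epsilon(k)},\mathbf e_{\check\epsilon(k)}]$, $\Xi_k(\tilde{\mathbf V})=\mathbf S_k^T\tilde{\mathbf V}\mathbf S_k\in\mathbb S^2$. Maximize the welfare over $\tilde{\mathbf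 V}\in\tilde{\mathbb S}^{N_V}$, $\mathbf p$, $\mathbf g_n\in\mathcal G_n$, $\mathbf d_n\in\mathcal D_n$ subject to (PB), (IN) with $\mathbf W=\tilde{\mathbf V}$ and $\Xi_k(\tilde{\mathbf V})\succeq\mathbf 0$ for all $k\in\mathcal E$. The SOC relaxation is exact if it has an optimal solution whose $\tilde{\mathbf V}^\star$ permits a psd rank-1 completion, i.e., there is a psd rank-1 matrix $\mathbf V\in\mathbb S^{N_V}$ with $[\mathbf V]_{i,j}=[\tilde{\mathbf V}^\star]_{i,j}$ for all $(i,j)\in\mathcal I$. *)

theory Defs
  imports "HOL-Analysis.Analysis"
begin

section \<open>Hermitian and positive semidefinite matrices\<close>

definition conj_transpose :: "complex^'n^'m \<Rightarrow> complex^'m^'n" where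
  "conj_transpose A = (\<chi> i j. cnj (A $ j $ i))"

definition hermitian :: "complex^'n^'n \<Rightarrow> bool" where
  "hermitian A \<longleftrightarrow> conj_transpose A = A"

text \<open>The quadratic form of a Hermitian matrix is real-valued, so taking its real part
  discards nothing.\<close>

definition psd :: "complex^'n^'n \<Rightarrow> bool" where
  "psd A \<longleftrightarrow> hermitian A \<and> (\<forall>x :: complex^'n. 0 \<le> Re (\<Sum>i\<in>UNIV. cnj (x $ i) * (A *v x) $ i))"

text \<open>The matrix \<open>v v\<^sup>H\<close>.\<close>

definition outer :: "complex^'n \<Rightarrow> complex^'n^'n" where
  "outer v = (\<chi> i j. v $ i * cnj (v $ j))"

text \<open>The trace of a product of two Hermitian matrices is real (lemma below), so the
  real part serves only to convert the type.\<close>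

definition tr_prod :: "complex^'n^'n \<Rightarrow> complex^'n^'n \<Rightarrow> real" where
  "tr_prod A W = Re (trace (A ** W))"

lemma trace_hermitian_prod_real:
  assumes "hermitian A" and "hermitian W"
  shows "trace (A ** W) = complex_of_real (tr_prod A W)"
proof -
  have A: "cnj (A $ i $ j) = A $ j $ i" and W: "cnj (W $ i $ j) = W $ j $ i" for i j
    using assms by (metis (no_types, lifting) hermitian_def conj_transpose_def vec_lambda_beta)+
  have "cnj (trace (A ** W)) = (\<Sum>i\<in>UNIV. \<Sum>k\<in>UNIV. A $ k $ i * W $ i $ k)"
    by (simp add: trace_def matrix_matrix_mult_def A W)
  also have "\<dots> = (\<Sum>k\<in>UNIV. \<Sum>i\<in>UNIV. A $ k $ i * W $ i $ k)"
    by (rule sum.swap)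
  also have "\<dots> = trace (A ** W)"
    by (simp add: trace_def matrix_matrix_mult_def)
  finally show ?thesis
    unfolding tr_prod_def by (metis Reals_cnj_iff of_real_Re)
qed


section \<open>Grid data\<close>

text \<open>Buses and AC branches are the elements of the finite types \<open>'v\<close> and \<open>'e\<close>; both index sets
  are nonempty, since every bus is an endpoint of some AC branch. There may be no DC branch at all,
  so the DC branches form a possibly empty subset \<open>dc\<close> of a finite type \<open>'d\<close>, and the space
  of DC flow vectors is the subspace of \<open>real^'d\<close> of vectors supported on \<open>dc\<close>. Costs, benefits
  and DC flow bounds are total functions or vectors, only used on their proper domains.\<close>

record ('v, 'e, 'd) grid =
  src :: "'e \<Rightarrow> 'v"
  dst :: "'e \<Rightarrow> 'v"
  dc :: "'d set"
  P_mat :: "'v \<Rightarrow> complex^'v^'v"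
  Q_mat :: "'v \<Rightarrow> complex^'v^'v"
  h_vec :: "'v \<Rightarrow> real^'d"
  v_min :: "'v \<Rightarrow> real"
  v_max :: "'v \<Rightarrow> real"
  gen :: "'v \<Rightarrow> (real^2) set"
  load :: "'v \<Rightarrow> (real^2) set"
  cost :: "'v \<Rightarrow> real^2 \<Rightarrow> real"
  benefit :: "'v \<Rightarrow> real^2 \<Rightarrow> real"
  I_src :: "'e \<Rightarrow> complex^'v^'v"
  I_dst :: "'e \<Rightarrow> complex^'v^'v"
  J_src :: "'e \<Rightarrow> real"
  J_dst :: "'e \<Rightarrow> real"
  drop_min :: "'e \<Rightarrow> complex^'v^'v"
  drop_max :: "'e \<Rightarrow> complex^'v^'v"
  angle_mat :: "'e \<Rightarrow> complex^'v^'v"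
  angle_min :: "'e \<Rightarrow> complex^'v^'v"
  angle_max :: "'e \<Rightarrow> complex^'v^'v"
  p_min :: "real^'d"
  p_max :: "real^'d"

definition dc_space :: "('v::finite, 'e::finite, 'd::finite) grid \<Rightarrow> (real^'d) set" where
  "dc_space N = {p. \<forall>l. l \<notin> dc N \<longrightarrow> p $ l = 0}"

definition I_set :: "('v::finite, 'e::finite, 'd::finite) grid \<Rightarrow> ('v \<times> 'v) set" where
  "I_set N = {(i, j). \<exists>k. i \<in> {src N k, dst N k} \<and> j \<in> {src N k, dst N k}}"

definition sparse_hermitian ::
  "('v::finite, 'e::finite, 'd::finite) grid \<Rightarrow> (complex^'v^'v) set" where
  "sparse_hermitian N = {A. hermitian A \<and> (\<forall>i j. (i, j) \<notin> I_set N \<longrightarrow> A $ i $ j = 0)}"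

definition grid_ok :: "('v::finite, 'e::finite, 'd::finite) grid \<Rightarrow> bool" where
  "grid_ok N \<longleftrightarrow>
     (\<forall>k. src N k \<noteq> dst N k) \<and>
     (\<forall>k k'. {src N k, dst N k} = {src N k', dst N k'} \<longrightarrow> k = k') \<and>
     (\<forall>n. \<exists>k. n \<in> {src N k, dst N k}) \<and>
     (\<forall>n. P_mat N n \<in> sparse_hermitian N \<and> Q_mat N n \<in> sparse_hermitian N
          \<and> h_vec N n \<in> dc_space N
          \<and> 0 < v_min N n \<and> v_min N n \<le> v_max N n
          \<and> gen N n \<noteq> {} \<and> compact (gen N n) \<and> convex (gen N n)
          \<and> load N n \<noteq> {} \<and> compact (load N n) \<and> convex (load N n)
          \<and> convex_on (gen N n) (cost N n) \<and> concave_on (load N n) (benefit N n)) \<and>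
     (\<forall>k. I_src N k \<in> sparse_hermitian N \<and> I_dst N k \<in> sparse_hermitian N
          \<and> 0 \<le> J_src N k \<and> 0 \<le> J_dst N k
          \<and> drop_min N k \<in> sparse_hermitian N \<and> drop_max N k \<in> sparse_hermitian N
          \<and> angle_mat N k \<in> sparse_hermitian N
          \<and> angle_min N k \<in> sparse_hermitian N \<and> angle_max N k \<in> sparse_hermitian N)"


section \<open>Inequality constraints\<close>

datatype ('v, 'e, 'd) con =
    VMax 'v | VMin 'v
  | ISrc 'e | IDst 'e | DropMin 'e | DropMax 'e | Angle 'e | AngleMin 'e | AngleMax 'e
  | FlowMax 'd | FlowMin 'd

definition cons :: "('v::finite, 'e::finite, 'd::finite) grid \<Rightarrow> ('v, 'e, 'd) con set" where
  "cons N = range VMax \<union> range VMin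
     \<union> range ISrc \<union> range IDst \<union> range DropMin \<union> range DropMax
     \<union> range Angle \<union> range AngleMin \<union> range AngleMax
     \<union> FlowMax ` dc N \<union> FlowMin ` dc N"

primrec con_mat ::
  "('v::finite, 'e::finite, 'd::finite) grid \<Rightarrow> ('v, 'e, 'd) con \<Rightarrow> complex^'v^'v" where
  "con_mat N (VMax n) = outer (axis n 1)"
| "con_mat N (VMin n) = - outer (axis n 1)"
| "con_mat N (ISrc k) = I_src N k"
| "con_mat N (IDst k) = I_dst N k"
| "con_mat N (DropMin k) = drop_min N k"
| "con_mat N (DropMax k) = drop_max N k"
| "con_mat N (Angle k) = angle_mat N k"
| "con_mat N (AngleMin k) = angle_min N k"
| "con_mat N (AngleMax k) = angle_max N k"
| "con_mat N (FlowMax l) = 0"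
| "con_mat N (FlowMin l) = 0"

primrec con_vec :: "('v::finite, 'e::finite, 'd::finite) con \<Rightarrow> real^'d" where
  "con_vec (VMax n) = 0"
| "con_vec (VMin n) = 0"
| "con_vec (ISrc k) = 0"
| "con_vec (IDst k) = 0"
| "con_vec (DropMin k) = 0"
| "con_vec (DropMax k) = 0"
| "con_vec (Angle k) = 0"
| "con_vec (AngleMin k) = 0"
| "con_vec (AngleMax k) = 0"
| "con_vec (FlowMax l) = axis l 1"
| "con_vec (FlowMin l) = - axis l 1"

primrec con_bound ::
  "('v::finite, 'e::finite, 'd::finite) grid \<Rightarrow> ('v, 'e, 'd) con \<Rightarrow> real" where
  "con_bound N (VMax n) = (v_max N n)\<^sup>2"
| "con_bound N (VMin n) = - (v_min N n)\<^sup>2"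
| "con_bound N (ISrc k) = (J_src N k)\<^sup>2"
| "con_bound N (IDst k) = (J_dst N k)\<^sup>2"
| "con_bound N (DropMin k) = 0"
| "con_bound N (DropMax k) = 0"
| "con_bound N (Angle k) = 0"
| "con_bound N (AngleMin k) = 0"
| "con_bound N (AngleMax k) = 0"
| "con_bound N (FlowMax l) = p_max N $ l"
| "con_bound N (FlowMin l) = - p_min N $ l"

lemma finite_cons: "finite (cons N)"
  by (simp add: cons_def)

lemma card_cons:
  fixes N :: "('v::finite, 'e::finite, 'd::finite) grid"
  shows "card (cons N) = 2 * CARD('v) + 7 * CARD('e) + 2 * card (dc N)"
  unfolding cons_def
  by (subst card_Un_disjoint, simp, simp, force)+ (simp add: card_image inj_on_def)


section \<open>Optimal power flow\<close>

definition power_balance ::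
  "('v::finite, 'e::finite, 'd::finite) grid \<Rightarrow> complex^'v^'v \<Rightarrow> real^'d
    \<Rightarrow> ('v \<Rightarrow> real^2) \<Rightarrow> ('v \<Rightarrow> real^2) \<Rightarrow> bool" where
  "power_balance N W p g d \<longleftrightarrow>
     (\<forall>n. tr_prod (P_mat N n) W + h_vec N n \<bullet> p = (g n - d n) $ 1
        \<and> tr_prod (Q_mat N n) W = (g n - d n) $ 2)"

definition con_lhs ::
  "('v::finite, 'e::finite, 'd::finite) grid \<Rightarrow> complex^'v^'v \<Rightarrow> real^'d
    \<Rightarrow> ('v, 'e, 'd) con \<Rightarrow> real" where
  "con_lhs N W p m = tr_prod (con_mat N m) W + con_vec m \<bullet> p"

definition welfare ::
  "('v::finite, 'e::finite, 'd::finite) grid \<Rightarrow> ('v \<Rightarrow> real^2) \<Rightarrow> ('v \<Rightarrow> real^2) \<Rightarrow> real" where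
  "welfare N g d = (\<Sum>n\<in>UNIV. benefit N n (d n)) - (\<Sum>n\<in>UNIV. cost N n (g n))"

definition injections_ok ::
  "('v::finite, 'e::finite, 'd::finite) grid \<Rightarrow> real^'d \<Rightarrow> ('v \<Rightarrow> real^2) \<Rightarrow> ('v \<Rightarrow> real^2) \<Rightarrow> bool"
  where
  "injections_ok N p g d \<longleftrightarrow> p \<in> dc_space N \<and> (\<forall>n. g n \<in> gen N n \<and> d n \<in> load N n)"

definition opf_feasible ::
  "('v::finite, 'e::finite, 'd::finite) grid \<Rightarrow> complex^'v \<Rightarrow> real^'d
    \<Rightarrow> ('v \<Rightarrow> real^2) \<Rightarrow> ('v \<Rightarrow> real^2) \<Rightarrow> bool" where
  "opf_feasible N v p g d \<longleftrightarrow>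
     injections_ok N p g d \<and> power_balance N (outer v) p g d
     \<and> (\<forall>m\<in>cons N. con_lhs N (outer v) p m \<le> con_bound N m)"

text \<open>Optimal values are extended reals, so that they are suprema and infima without any
  boundedness or feasibility proviso.\<close>

definition opf_value :: "('v::finite, 'e::finite, 'd::finite) grid \<Rightarrow> ereal" where
  "opf_value N = (SUP (v, p, g, d) \<in> {(v, p, g, d). opf_feasible N v p g d}. ereal (welfare N g d))"

definition strict_feasibility :: "('v::finite, 'e::finite, 'd::finite) grid \<Rightarrow> bool" where
  "strict_feasibility N \<longleftrightarrow>
     (\<exists>v p g d. opf_feasible N v p g d
        \<and> (\<forall>m\<in>cons N. con_lhs N (outer v) p m < con_bound N m)
        \<and> (\<forall>n. g n - d n \<in> interior {x - y |x y. x \<in> gen N n \<and> y \<in> load N n}))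
     \<and> (\<forall>n. polyhedron (gen N n) \<and> polyhedron (load N n))"


section \<open>Lagrangian dual\<close>

definition dual_mat ::
  "('v::finite, 'e::finite, 'd::finite) grid \<Rightarrow> ('v \<Rightarrow> real^2) \<Rightarrow> (('v, 'e, 'd) con \<Rightarrow> real)
    \<Rightarrow> complex^'v^'v" where
  "dual_mat N lam mu =
     (\<Sum>n\<in>UNIV. (lam n $ 1) *\<^sub>R P_mat N n + (lam n $ 2) *\<^sub>R Q_mat N n)
     + (\<Sum>m\<in>cons N. mu m *\<^sub>R con_mat N m)"

definition dual_vec ::
  "('v::finite, 'e::finite, 'd::finite) grid \<Rightarrow> ('v \<Rightarrow> real^2) \<Rightarrow> (('v, 'e, 'd) con \<Rightarrow> real)
    \<Rightarrow> real^'d" where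
  "dual_vec N lam mu =
     (\<Sum>n\<in>UNIV. (lam n $ 1) *\<^sub>R h_vec N n) + (\<Sum>m\<in>cons N. mu m *\<^sub>R con_vec m)"

definition load_surplus ::
  "('v::finite, 'e::finite, 'd::finite) grid \<Rightarrow> 'v \<Rightarrow> real^2 \<Rightarrow> ereal" where
  "load_surplus N n lam = (SUP d \<in> load N n. ereal (benefit N n d - lam \<bullet> d))"

definition gen_surplus ::
  "('v::finite, 'e::finite, 'd::finite) grid \<Rightarrow> 'v \<Rightarrow> real^2 \<Rightarrow> ereal" where
  "gen_surplus N n lam = (SUP g \<in> gen N n. ereal (lam \<bullet> g - cost N n g))"

definition dual_feasible ::
  "('v::finite, 'e::finite, 'd::finite) grid \<Rightarrow> ('v \<Rightarrow> real^2) \<Rightarrow> (('v, 'e, 'd) con \<Rightarrow> real) \<Rightarrow> bool"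
  where
  "dual_feasible N lam mu \<longleftrightarrow>
     (\<forall>m\<in>cons N. 0 \<le> mu m) \<and> psd (dual_mat N lam mu) \<and> dual_vec N lam mu = 0"

definition dual_objective ::
  "('v::finite, 'e::finite, 'd::finite) grid \<Rightarrow> ('v \<Rightarrow> real^2) \<Rightarrow> (('v, 'e, 'd) con \<Rightarrow> real) \<Rightarrow> ereal"
  where
  "dual_objective N lam mu =
     ereal (\<Sum>m\<in>cons N. mu m * con_bound N m)
     + (\<Sum>n\<in>UNIV. load_surplus N n (lam n)) + (\<Sum>n\<in>UNIV. gen_surplus N n (lam n))"

definition dual_value :: "('v::finite, 'e::finite, 'd::finite) grid \<Rightarrow> ereal" where
  "dual_value N = (INF (lam, mu) \<in> {(lam, mu). dual_feasible N lam mu}. dual_objective N lam mu)"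


section \<open>Second-order cone relaxation\<close>

text \<open>\<open>sel_mat N k\<close> is the matrix with the two columns \<open>axis (src N k) 1\<close> and \<open>axis (dst N k) 1\<close>.\<close>

definition sel_mat :: "('v::finite, 'e::finite, 'd::finite) grid \<Rightarrow> 'e \<Rightarrow> complex^2^'v" where
  "sel_mat N k = transpose (vector [axis (src N k) 1, axis (dst N k) 1])"

definition branch_mat ::
  "('v::finite, 'e::finite, 'd::finite) grid \<Rightarrow> 'e \<Rightarrow> complex^'v^'v \<Rightarrow> complex^2^2" where
  "branch_mat N k V = transpose (sel_mat N k) ** V ** sel_mat N k"

lemma branch_mat_nth:
  "branch_mat N k V $ a $ b =
     V $ (if a = 1 then src N k else dst N k) $ (if b = 1 then src N k else dst N k)"
proof -
  have S: "sel_mat N k $ i $ c = (if i = (if c = 1 then src N k else dst N k) then 1 else 0)" for i c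
    using exhaust_2[of c] by (auto simp: sel_mat_def transpose_def axis_def)
  show ?thesis
    by (simp add: branch_mat_def matrix_matrix_mult_def transpose_def S
        if_distrib[of "\<lambda>x. x * _"] if_distrib[of "\<lambda>x. _ * x"] cong: if_cong)
qed

definition soc_feasible ::
  "('v::finite, 'e::finite, 'd::finite) grid \<Rightarrow> complex^'v^'v \<Rightarrow> real^'d
    \<Rightarrow> ('v \<Rightarrow> real^2) \<Rightarrow> ('v \<Rightarrow> real^2) \<Rightarrow> bool" where
  "soc_feasible N V p g d \<longleftrightarrow>
     V \<in> sparse_hermitian N \<and> injections_ok N p g d \<and> power_balance N V p g d
     \<and> (\<forall>m\<in>cons N. con_lhs N V p m \<le> con_bound N m)
     \<and> (\<forall>k. psd (branch_mat N k V))"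

definition soc_optimal ::
  "('v::finite, 'e::finite, 'd::finite) grid \<Rightarrow> complex^'v^'v \<Rightarrow> real^'d
    \<Rightarrow> ('v \<Rightarrow> real^2) \<Rightarrow> ('v \<Rightarrow> real^2) \<Rightarrow> bool" where
  "soc_optimal N V p g d \<longleftrightarrow> soc_feasible N V p g d
     \<and> (\<forall>V' p' g' d'. soc_feasible N V' p' g' d' \<longrightarrow> welfare N g' d' \<le> welfare N g d)"

definition rank1_completable ::
  "('v::finite, 'e::finite, 'd::finite) grid \<Rightarrow> complex^'v^'v \<Rightarrow> bool" where
  "rank1_completable N V \<longleftrightarrow>
     (\<exists>U. psd U \<and> rank U = 1 \<and> (\<forall>(i, j) \<in> I_set N. U $ i $ j = V $ i $ j))"

definition soc_exact :: "('v::finite, 'e::finite, 'd::finite) grid \<Rightarrow> bool" where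
  "soc_exact N \<longleftrightarrow> (\<exists>V p g d. soc_optimal N V p g d \<and> rank1_completable N V)"

end

theory Submission
  imports Defs
begin

text \<open>The dual of the OPF problem is also the dual of its semidefinite relaxation, in which
  \<open>v v\<^sup>H\<close> is replaced by an arbitrary psd \<open>W\<close>. Restricting such a \<open>W\<close> to the sparsity pattern gives
  an SOC-feasible point, so the semidefinite optimum lies between the OPF and the SOC optimum; if
  the SOC relaxation is exact, a psd rank-1 completion has the form \<open>v v\<^sup>H\<close> and the three optima
  coincide. It remains to prove strong duality for the convex semidefinite relaxation. Slater's
  condition only asks that zero be an interior point of the set of attainable power
  mismatches, which the interior condition on \<open>g - d\<close> ensures; no positive definite \<open>W\<close>
  is needed.\<close>

section \<open>Lagrange duality for convex programs\<close>

text \<open>A negative slope would drag the affine function below zero for large \<open>s\<close>.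
  All sign and feasibility properties of the multipliers are read off this way, by moving along a
  ray on which a known inequality persists.\<close>

lemma nonneg_slopeI:
  fixes k c :: real
  assumes "\<And>s. 0 \<le> s \<Longrightarrow> 0 \<le> c + s * k"
  shows "0 \<le> k"
proof (rule ccontr)
  assume k: "\<not> 0 \<le> k"
  define s where "s = (\<bar>c\<bar> + 1) / (- k)"
  have "0 \<le> s" unfolding s_def using k by (intro divide_nonneg_pos) auto
  moreover have "s * k = - (\<bar>c\<bar> + 1)" using k by (simp add: s_def)
  ultimately show False using assms[of s] by linarith
qed

text \<open>Zero is separated from the set \<open>S\<close> of attainable triples (gain over
  \<open>v\<close>, value of \<open>A\<close>, slacks). Only this image has to be
  finite-dimensional, so \<open>'x\<close> carries no topology. The point \<open>xf\<close> handles
  the inequalities and the interior condition handles the equation \<open>A x = 0\<close>.\<close>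

lemma lagrange_multipliers:
  fixes A :: "'x::real_vector \<Rightarrow> 'y::euclidean_space" and r :: "'i::finite \<Rightarrow> 'x \<Rightarrow> real"
  assumes f: "concave_on K f" and A: "linear A" and r: "\<And>i. i \<in> I \<Longrightarrow> convex_on K (r i)"
    and opt: "\<And>x. x \<in> K \<Longrightarrow> A x = 0 \<Longrightarrow> (\<And>i. i \<in> I \<Longrightarrow> r i x \<le> 0) \<Longrightarrow> f x \<le> v"
    and int: "0 \<in> interior (A ` K)"
    and xf: "xf \<in> K" "A xf = 0" "\<And>i. i \<in> I \<Longrightarrow> r i xf < 0"
  obtains l u where "\<And>i. i \<in> I \<Longrightarrow> 0 \<le> u i"
    "\<And>x. x \<in> K \<Longrightarrow> f x \<le> v + l \<bullet> A x + (\<Sum>i\<in>I. u i * r i x)"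
proof -
  have K: "convex K" using f concave_on_imp_convex by blast
  \<comment> \<open>Trivial slack constraints outside \<open>I\<close> let the slack vector range over all of \<open>real^'i\<close>.\<close>
  define q where "q i = (if i \<in> I then r i else (\<lambda>_. -1))" for i
  have q: "convex_on K (q i)" and q0: "q i xf < 0" for i
    using r xf K by (auto simp: q_def convex_on_const)
  \<comment> \<open>The strict bound on \<open>t\<close> keeps zero out of \<open>S\<close>: zero in
    \<open>S\<close> would be a feasible point with value above \<open>v\<close>.\<close>
  define S :: "(real \<times> 'y \<times> (real^'i)) set" where
    "S = {(t, y, z). \<exists>x\<in>K. y = A x \<and> t < f x - v \<and> (\<forall>i. q i x \<le> z $ i)}"
  have "convex S"
  proof (rule convexI)
    fix s s' :: "real \<times> 'y \<times> (real^'i)" and a b :: real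
    assume s: "s \<in> S" "s' \<in> S" and ab: "0 \<le> a" "0 \<le> b" "a + b = 1"
    obtain t y z t' y' z' where st: "s = (t, y, z)" "s' = (t', y', z')"
      by (metis surj_pair)
    obtain x where x: "x \<in> K" "y = A x" "t < f x - v" "\<And>i. q i x \<le> z $ i"
      using s(1) by (auto simp: S_def st)
    obtain x' where x': "x' \<in> K" "y' = A x'" "t' < f x' - v" "\<And>i. q i x' \<le> z' $ i"
      using s(2) by (auto simp: S_def st)
    define w where "w = a *\<^sub>R x + b *\<^sub>R x'"
    have "w \<in> K" unfolding w_def using K x(1) x'(1) ab by (rule convexD)
    moreover have "A w = a *\<^sub>R y + b *\<^sub>R y'"
      by (simp add: w_def linear_add[OF A] linear_scale[OF A] x x')
    moreover have "a * t + b * t' < f w - v"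
    proof -
      have "a * f x + b * f x' \<le> f w"
        using f x(1) x'(1) ab unfolding w_def concave_on_iff by blast
      moreover have "a * t + b * t' < a * (f x - v) + b * (f x' - v)"
      proof (cases "a = 0")
        case True
        then show ?thesis using ab x'(3) by simp
      next
        case False
        then have "a * t < a * (f x - v)" using ab x(3) by simp
        moreover have "b * t' \<le> b * (f x' - v)"
          using ab x'(3) by (intro mult_left_mono) auto
        ultimately show ?thesis by linarith
      qed
      moreover have "a * v + b * v = v" using ab(3) by (metis distrib_right mult_1)
      ultimately show ?thesis by (simp add: algebra_simps)
    qed
    moreover have "q i w \<le> a * z $ i + b * z' $ i" for i
    proof -
      have "q i w \<le> a * q i x + b * q i x'"
        using q[of i] x(1) x'(1) ab unfolding w_def convex_on_def by blast
      also have "\<dots> \<le> a * z $ i + b * z' $ i"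
        using ab x(4) x'(4) by (intro add_mono mult_left_mono) auto
      finally show ?thesis .
    qed
    ultimately show "a *\<^sub>R s + b *\<^sub>R s' \<in> S"
      by (auto simp: S_def st intro!: bexI[of _ w])
  qed
  moreover have "0 \<notin> S"
  proof
    assume "0 \<in> S"
    then obtain x where x: "x \<in> K" "A x = 0" "0 < f x - v" "\<And>i. q i x \<le> 0"
      by (auto simp: S_def zero_prod_def)
    have "r i x \<le> 0" if "i \<in> I" for i using x(4)[of i] that by (simp add: q_def)
    then show False using opt[of x] x by auto
  qed
  ultimately obtain c where "c \<noteq> 0" and c: "\<forall>s\<in>S. 0 \<le> c \<bullet> s"
    using separating_hyperplane_set_0 by blast
  obtain al l m where clm: "c = (al, l, m)" by (metis surj_pair)
  have sep: "0 \<le> al * t + l \<bullet> A x + (\<Sum>i\<in>UNIV. m $ i * z i)"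
    if "x \<in> K" "t < f x - v" "\<And>i. q i x \<le> z i" for t x z
  proof -
    have "(t, A x, \<chi> i. z i) \<in> S" using that by (auto simp: S_def)
    from c[rule_format, OF this] show ?thesis
      by (simp add: clm inner_prod_def inner_vec_def)
  qed
  \<comment> \<open>\<open>S\<close> is closed under enlarging slacks and lowering \<open>t\<close>.
    Both rays start at \<open>xf\<close>, with \<open>f xf - v - 1\<close> as a first component that
    is surely admissible; they give the signs of \<open>m\<close> and \<open>al\<close>.\<close>
  have m: "0 \<le> m $ i" for i
  proof (rule nonneg_slopeI)
    fix s :: real assume "0 \<le> s"
    then have "0 \<le> al * (f xf - v - 1) + l \<bullet> A xf
      + (\<Sum>j\<in>UNIV. m $ j * (q j xf + (if j = i then s else 0)))"
      by (intro sep xf) auto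
    then show "0 \<le> (al * (f xf - v - 1) + (\<Sum>j\<in>UNIV. m $ j * q j xf)) + s * m $ i"
      by (simp add: xf distrib_left sum.distrib if_distrib[of "\<lambda>x. _ * x"] algebra_simps cong: if_cong)
  qed
  have al: "0 \<le> - al"
  proof (rule nonneg_slopeI)
    fix s :: real assume "0 \<le> s"
    then have "0 \<le> al * (f xf - v - 1 - s) + l \<bullet> A xf + (\<Sum>j\<in>UNIV. m $ j * q j xf)"
      by (intro sep xf) auto
    then show "0 \<le> (al * (f xf - v - 1) + (\<Sum>j\<in>UNIV. m $ j * q j xf)) + s * - al"
      by (simp add: xf algebra_simps)
  qed
  \<comment> \<open>The hyperplane is not vertical: if \<open>al = 0\<close>, strict feasibility of
    \<open>xf\<close> forces \<open>m = 0\<close>, then the interior condition forces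
    \<open>l = 0\<close>, against \<open>c \<noteq> 0\<close>.\<close>
  have "al \<noteq> 0"
  proof
    assume al0: "al = 0"
    have "0 \<le> (\<Sum>j\<in>UNIV. m $ j * q j xf)"
      using sep[of xf "f xf - v - 1" "\<lambda>j. q j xf"] xf al0 by simp
    moreover have nonpos: "m $ j * q j xf \<le> 0" for j
      using m[of j] q0[of j] by (simp add: mult_nonneg_nonpos)
    ultimately have "(\<Sum>j\<in>UNIV. - (m $ j * q j xf)) = 0"
      by (simp add: sum_negf sum_nonpos order_antisym)
    then have "\<forall>j. m $ j * q j xf = 0"
      using nonpos by (subst (asm) sum_nonneg_eq_0_iff) auto
    then have m0: "m = 0" using q0 by (metis less_irrefl mult_eq_0_iff vec_eq_iff zero_index)
    have lA: "0 \<le> l \<bullet> A x" if "x \<in> K" for x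
      using sep[of x "f x - v - 1" "\<lambda>j. q j x"] that al0 m0 by simp
    obtain e where e: "0 < e" "ball 0 e \<subseteq> A ` K"
      using int by (auto simp: mem_interior)
    have "l = 0"
    proof (rule ccontr)
      assume l: "l \<noteq> 0"
      \<comment> \<open>A vector of norm \<open>e / 2\<close> opposite to \<open>l\<close>: it is
        attained by \<open>A\<close> on \<open>K\<close>, yet has a negative inner product with
        \<open>l\<close>.\<close>
      define w where "w = (- (e / (2 * norm l))) *\<^sub>R l"
      have "w \<in> ball 0 e" using l e by (simp add: w_def)
      then obtain x where "x \<in> K" "w = A x" using e by blast
      then have "0 \<le> l \<bullet> w" using lA by auto
      moreover have "l \<bullet> w < 0" using l e by (simp add: w_def)
      ultimately show False by simp
    qed
    then show False using \<open>c \<noteq> 0\<close> clm al0 m0 by (simp add: zero_prod_def)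
  qed
  with al have be: "0 < - al" by simp
  \<comment> \<open>Dividing by \<open>- al\<close> normalizes the coefficient of \<open>f\<close>
    to one.\<close>
  have "f x \<le> v + (l /\<^sub>R - al) \<bullet> A x + (\<Sum>i\<in>I. m $ i / - al * r i x)" if x: "x \<in> K" for x
  proof -
    define R where "R = l \<bullet> A x + (\<Sum>i\<in>UNIV. m $ i * q i x)"
    have le: "f x - v \<le> R / - al"
    \<comment> \<open>In \<open>S\<close> the component \<open>t\<close> only approaches
      \<open>f x - v\<close> from below.\<close>
    proof (rule field_le_epsilon)
      fix e :: real assume "0 < e"
      then have "0 \<le> al * (f x - v - e) + R"
        using sep[of x "f x - v - e" "\<lambda>i. q i x"] x by (simp add: R_def)
      then show "f x - v \<le> R / - al + e" using be by (simp add: field_simps)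
    qed
    \<comment> \<open>The padding constraints equal -1 and have nonnegative multipliers, so omitting
      them can only raise the sum.\<close>
    have R: "R \<le> l \<bullet> A x + (\<Sum>i\<in>I. m $ i * r i x)"
    proof -
      have "(\<Sum>i\<in>UNIV. m $ i * q i x) = (\<Sum>i\<in>I. m $ i * r i x) + (\<Sum>i\<in>-I. - (m $ i))"
        by (subst sum.subset_diff[of I]) (auto simp: q_def Compl_eq_Diff_UNIV intro!: sum.cong)
      moreover have "(\<Sum>i\<in>-I. - (m $ i)) \<le> 0" using m by (intro sum_nonpos) auto
      ultimately show ?thesis by (simp add: R_def)
    qed
    note le
    also have "R / - al \<le> (l \<bullet> A x + (\<Sum>i\<in>I. m $ i * r i x)) / - al"
      using R be by (intro divide_right_mono) auto
    also have "\<dots> = (l /\<^sub>R - al) \<bullet> A x + (\<Sum>i\<in>I. m $ i / - al * r i x)"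
      by (simp add: add_divide_distrib sum_divide_distrib sum_negf sum_distrib_left divide_inverse algebra_simps)
    finally show ?thesis by linarith
  qed
  moreover have "0 \<le> m $ i / - al" for i using m be by (metis divide_nonneg_pos)
  ultimately show thesis by (intro that[of "\<lambda>i. m $ i / - al" "l /\<^sub>R - al"])
qed

section \<open>Suprema of separable sums\<close>

text \<open>The coordinates of \<open>x\<close> are chosen independently: fixing the one at
  \<open>j\<close> to \<open>y\<close>, induction bounds the remaining suprema by
  \<open>c - f j y\<close>, and then \<open>y\<close> varies.\<close>

lemma sum_SUP_ereal_le:
  fixes f :: "'i \<Rightarrow> 'a \<Rightarrow> real"
  assumes "finite I" and "\<And>i. i \<in> I \<Longrightarrow> A i \<noteq> {}"
    and "\<And>x. (\<And>i. i \<in> I \<Longrightarrow> x i \<in> A i) \<Longrightarrow> (\<Sum>i\<in>I. f i (x i)) \<le> c"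
  shows "(\<Sum>i\<in>I. SUP x\<in>A i. ereal (f i x)) \<le> ereal c"
  using assms
proof (induction I arbitrary: c rule: finite_induct)
  case empty
  then show ?case by simp
next
  case (insert j I)
  define S where "S = (\<Sum>i\<in>I. SUP x\<in>A i. ereal (f i x))"
  have S: "S \<le> ereal (c - f j y)" if y: "y \<in> A j" for y
    unfolding S_def
  proof (rule insert.IH)
    fix x assume x: "\<And>i. i \<in> I \<Longrightarrow> x i \<in> A i"
    have "(\<Sum>i\<in>insert j I. f i ((x(j := y)) i)) \<le> c"
      using x y insert.hyps by (intro insert.prems) auto
    moreover have "(\<Sum>i\<in>I. f i ((x(j := y)) i)) = (\<Sum>i\<in>I. f i (x i))"
      using insert.hyps by (intro sum.cong) auto
    ultimately show "(\<Sum>i\<in>I. f i (x i)) \<le> c - f j y" using insert.hyps by simp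
  qed (use insert.prems in auto)
  \<comment> \<open>Some choice of points bounds \<open>S\<close> below, and any \<open>y\<close> in
    \<open>A j\<close> bounds it above. Thus \<open>S\<close> is finite and can be moved across the
    inequality.\<close>
  have "\<forall>i\<in>I. \<exists>x. x \<in> A i" using insert.prems(1) by blast
  then obtain x where x: "\<forall>i\<in>I. x i \<in> A i" by (rule bchoice[THEN exE])
  have "ereal (\<Sum>i\<in>I. f i (x i)) \<le> S"
    unfolding S_def sum_ereal[symmetric] using x by (intro sum_mono SUP_upper) auto
  then have "S \<noteq> -\<infinity>" by auto
  moreover have "S \<noteq> \<infinity>" using S insert.prems(1)[of j] by fastforce
  ultimately obtain s where s: "S = ereal s" by (cases S) auto
  have "(SUP x\<in>A j. ereal (f j x)) \<le> ereal (c - s)"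
    using S by (intro SUP_least) (force simp: s)
  then have "(SUP x\<in>A j. ereal (f j x)) + S \<le> ereal (c - s) + S" by (rule add_right_mono)
  then show ?case using insert.hyps by (simp add: S_def[symmetric] s)
qed

section \<open>Positive semidefinite matrices\<close>

lemma hermitian_iff: "hermitian A \<longleftrightarrow> (\<forall>i j. cnj (A $ i $ j) = A $ j $ i)"
  by (auto simp: hermitian_def conj_transpose_def vec_eq_iff)

lemma tr_prod_eq_sum: "tr_prod A W = (\<Sum>i\<in>UNIV. \<Sum>j\<in>UNIV. Re (A $ i $ j * W $ j $ i))"
  by (simp add: tr_prod_def trace_def matrix_matrix_mult_def)

lemma tr_prod_commute: "tr_prod A W = tr_prod W A"
  unfolding tr_prod_def by (rule arg_cong[OF trace_mul_sym])

lemma linear_tr_prod: "linear (tr_prod A)"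
proof (rule linearI)
  show "tr_prod A (U + V) = tr_prod A U + tr_prod A V" for U V
    by (simp only: tr_prod_eq_sum vector_add_component distrib_left plus_complex.sel sum.distrib)
  show "tr_prod A (c *\<^sub>R U) = c *\<^sub>R tr_prod A U" for c U
    by (simp only: tr_prod_eq_sum vector_scaleR_component mult_scaleR_right scaleR_complex.sel
        real_scaleR_def sum_distrib_left)
qed

lemma tr_prod_add_left: "tr_prod (A + B) W = tr_prod A W + tr_prod B W"
  using linear_add[OF linear_tr_prod, of W A B] by (simp only: tr_prod_commute)

lemma tr_prod_scaleR_left: "tr_prod (c *\<^sub>R A) W = c * tr_prod A W"
  using linear_scale[OF linear_tr_prod, of W c A] by (simp only: tr_prod_commute real_scaleR_def)

lemma tr_prod_sum_left: "tr_prod (\<Sum>i\<in>I. F i) W = (\<Sum>i\<in>I. tr_prod (F i) W)"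
  using linear_sum[OF linear_tr_prod, of W F I] by (simp only: tr_prod_commute)

text \<open>Turns the quadratic form in \<open>psd\<close> into a pairing with a rank-one matrix, so
  that dual feasibility can be tested on primal matrices.\<close>

lemma tr_prod_outer: "tr_prod A (outer x) = Re (\<Sum>i\<in>UNIV. cnj (x $ i) * (A *v x) $ i)"
proof -
  have "trace (A ** outer x) = (\<Sum>i\<in>UNIV. cnj (x $ i) * (A *v x) $ i)"
    by (simp only: trace_def matrix_matrix_mult_def matrix_vector_mult_def outer_def
        vec_lambda_beta sum_distrib_left mult_ac)
  then show ?thesis by (simp add: tr_prod_def)
qed

lemma psd_iff_tr_prod: "psd A \<longleftrightarrow> hermitian A \<and> (\<forall>x. 0 \<le> tr_prod A (outer x))"
  by (simp add: psd_def tr_prod_outer)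

lemma psd_outer: "psd (outer v)"
proof -
  have "0 \<le> tr_prod (outer v) (outer x)" for x
  proof -
    \<comment> \<open>The inner product of \<open>v\<close> and \<open>x\<close>; the trace below is
      its squared modulus.\<close>
    define z where "z = (\<Sum>i\<in>UNIV. v $ i * cnj (x $ i))"
    have "trace (outer v ** outer x) = z * cnj z"
      unfolding z_def by (simp add: trace_def matrix_matrix_mult_def outer_def sum_product mult_ac)
    then show ?thesis by (simp add: tr_prod_def complex_mult_cnj)
  qed
  then show ?thesis by (simp add: psd_iff_tr_prod hermitian_iff outer_def mult.commute)
qed

lemma psd_0: "psd 0"
  by (simp add: psd_iff_tr_prod hermitian_iff tr_prod_eq_sum)

lemma psd_add: "psd A \<Longrightarrow> psd B \<Longrightarrow> psd (A + B)"
  by (simp add: psd_iff_tr_prod hermitian_iff tr_prod_add_left)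

lemma psd_scaleR: "0 \<le> c \<Longrightarrow> psd A \<Longrightarrow> psd (c *\<^sub>R A)"
  by (simp add: psd_iff_tr_prod hermitian_iff tr_prod_scaleR_left)

text \<open>All rows are multiples of one row, so every 2x2 minor vanishes. Some diagonal entry is
  positive, and the column through it, divided by the square root of that entry, is the desired
  \<open>v\<close>.\<close>

lemma psd_rank_1_eq_outer:
  assumes "psd U" and "rank U = 1"
  obtains v where "U = outer v"
proof -
  have herm: "cnj (U $ i $ j) = U $ j $ i" for i j
    using assms(1) by (simp add: psd_def hermitian_iff)
  obtain B where B: "B \<subseteq> rows U" "vec.independent B" "rows U \<subseteq> vec.span B" "card B = 1"
    using assms(2) vec.basis_exists[of "rows U"] by (metis row_rank_def_gen)
  then obtain w where w: "B = {w}" by (meson card_1_singletonE)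
  have "w \<noteq> 0" using B(2) w vec.dependent_zero by blast
  have "w \<in> rows U" using B w by blast
  have "\<exists>a. row i U = a *s w" for i
    using B(3) unfolding w vec.span_singleton rows_def by blast
  then obtain a where "\<And>i. row i U = a i *s w" by metis
  then have a: "U $ i $ j = a i * w $ j" for i j
    by (metis row_def vec_nth_inverse vector_smult_component)
  have minor: "U $ i $ j * U $ k $ l = U $ i $ l * U $ k $ j" for i j k l
    by (simp add: a)
  obtain i j where ij: "U $ i $ j \<noteq> 0"
    using \<open>w \<noteq> 0\<close> \<open>w \<in> rows U\<close> by (auto simp: rows_def row_def vec_eq_iff)
  \<comment> \<open>The vanishing minor on \<open>i\<close> and \<open>j\<close> carries a nonzero
    entry over to the diagonal.\<close>
  have "U $ i $ i * U $ j $ j = U $ i $ j * cnj (U $ i $ j)"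
    using minor[of i i j j] by (simp add: herm)
  then have ii: "U $ i $ i \<noteq> 0" using ij by auto
  have "0 \<le> tr_prod U (outer (axis i 1))" using assms(1) by (simp add: psd_iff_tr_prod)
  also have "\<dots> = Re (U $ i $ i)"
    by (simp add: tr_prod_outer matrix_vector_mult_def axis_def if_distrib[of "\<lambda>x. _ * x"]
        if_distrib[of cnj] if_distrib[of "\<lambda>x. x * _"] cong: if_cong)
  finally have "0 \<le> Re (U $ i $ i)" .
  moreover have real: "U $ i $ i = of_real (Re (U $ i $ i))"
    using herm[of i i] by (metis Reals_cnj_iff of_real_Re)
  ultimately have pos: "0 < Re (U $ i $ i)" using ii by (metis less_eq_real_def of_real_0)
  define v where "v = (\<chi> l. U $ l $ i / of_real (sqrt (Re (U $ i $ i))))"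
  have "U $ l $ k = v $ l * cnj (v $ k)" for l k
  proof -
    have "v $ l * cnj (v $ k) = U $ l $ i * U $ i $ k / of_real (Re (U $ i $ i))"
      using pos by (simp add: v_def herm flip: of_real_mult)
    also have "\<dots> = U $ l $ k * U $ i $ i / U $ i $ i"
      using minor[of l i i k] real by simp
    also have "\<dots> = U $ l $ k" using ii by simp
    finally show ?thesis by simp
  qed
  then have "U = outer v" by (simp add: outer_def vec_eq_iff)
  then show thesis by (rule that)
qed

section \<open>The semidefinite relaxation\<close>

lemma subspace_sparse_hermitian: "subspace (sparse_hermitian N)"
  by (auto simp: subspace_def sparse_hermitian_def hermitian_iff)

lemma subspace_dc_space: "subspace (dc_space N)"
  by (auto simp: subspace_def dc_space_def)

text \<open>For the voltage constraints this rests on every bus being an endpoint of a branch, which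
  puts the diagonal into \<open>I_set N\<close>.\<close>

lemma con_mat_sparse_hermitian:
  assumes "grid_ok N"
  shows "con_mat N m \<in> sparse_hermitian N"
proof -
  have "outer (axis n 1) \<in> sparse_hermitian N" for n
  proof -
    have "\<exists>k. n \<in> {src N k, dst N k}" using assms by (simp add: grid_ok_def)
    then have "(n, n) \<in> I_set N" by (auto simp: I_set_def)
    then show ?thesis by (auto simp: sparse_hermitian_def hermitian_iff outer_def axis_def)
  qed
  then show ?thesis
    using assms subspace_neg[OF subspace_sparse_hermitian] subspace_0[OF subspace_sparse_hermitian]
    by (cases m) (auto simp: grid_ok_def)
qed

lemma con_vec_dc_space: "m \<in> cons N \<Longrightarrow> con_vec m \<in> dc_space N"
  by (auto simp: cons_def dc_space_def axis_def)

lemma hermitian_dual_mat: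
  assumes "grid_ok N"
  shows "hermitian (dual_mat N lam mu)"
proof -
  have "dual_mat N lam mu \<in> sparse_hermitian N"
    using assms con_mat_sparse_hermitian[OF assms] unfolding dual_mat_def grid_ok_def
    by (intro subspace_add subspace_sum subspace_scale subspace_sparse_hermitian) auto
  then show ?thesis by (simp add: sparse_hermitian_def)
qed

text \<open>Makes \<open>dual_vec\<close> itself an admissible flow direction, along which it will
  be shown to vanish.\<close>

lemma dual_vec_dc_space:
  assumes "grid_ok N"
  shows "dual_vec N lam mu \<in> dc_space N"
  using assms con_vec_dc_space unfolding dual_vec_def grid_ok_def
  by (intro subspace_add subspace_sum subspace_scale subspace_dc_space) auto

text \<open>The trace pairs entry \<open>(i, j)\<close> of \<open>A\<close> with entry
  \<open>(j, i)\<close> of the other matrix; as the pattern is symmetric, entries off the pattern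
  meet a zero of \<open>A\<close>.\<close>

lemma tr_prod_sparse_cong:
  assumes "A \<in> sparse_hermitian N" and "\<And>i j. (i, j) \<in> I_set N \<Longrightarrow> U $ i $ j = V $ i $ j"
  shows "tr_prod A U = tr_prod A V"
proof -
  have "A $ i $ j * U $ j $ i = A $ i $ j * V $ j $ i" for i j
  proof (cases "(j, i) \<in> I_set N")
    case False
    then have "(i, j) \<notin> I_set N" by (auto simp: I_set_def)
    then show ?thesis using assms(1) by (simp add: sparse_hermitian_def)
  qed (simp add: assms(2))
  then show ?thesis by (simp only: tr_prod_eq_sum)
qed

text \<open>All constraint matrices are supported on the pattern. This moves feasibility between a
  sparse matrix and its completions.\<close>

lemma constraints_cong:
  assumes "grid_ok N" and "\<And>i j. (i, j) \<in> I_set N \<Longrightarrow> U $ i $ j = V $ i $ j"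
  shows "power_balance N U p g d = power_balance N V p g d"
    and "con_lhs N U p m = con_lhs N V p m"
proof -
  have tr: "tr_prod A U = tr_prod A V" if "A \<in> sparse_hermitian N" for A
    using that assms(2) by (rule tr_prod_sparse_cong)
  have "P_mat N n \<in> sparse_hermitian N" "Q_mat N n \<in> sparse_hermitian N" for n
    using assms(1) by (auto simp: grid_ok_def)
  then show "power_balance N U p g d = power_balance N V p g d"
    and "con_lhs N U p m = con_lhs N V p m"
    using tr con_mat_sparse_hermitian[OF assms(1)] by (simp_all add: power_balance_def con_lhs_def)
qed

lemma psd_branch_mat:
  assumes "psd W" and "src N k \<noteq> dst N k"
    and "\<And>i j. (i, j) \<in> I_set N \<Longrightarrow> V $ i $ j = W $ i $ j"
  shows "psd (branch_mat N k V)"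
proof -
  let ?s = "src N k" and ?t = "dst N k"
  have nth: "branch_mat N k V $ a $ b = W $ (if a = 1 then ?s else ?t) $ (if b = 1 then ?s else ?t)"
    for a b
    unfolding branch_mat_nth by (intro assms(3)) (auto simp: I_set_def)
  have "0 \<le> Re (\<Sum>a\<in>UNIV. cnj (x $ a) * (branch_mat N k V *v x) $ a)" for x
  proof -
    \<comment> \<open>This is \<open>sel_mat N k *v x\<close>: the form of the branch matrix at
      \<open>x\<close> equals the form of \<open>W\<close> at \<open>y\<close>.\<close>
    define y :: "complex^'a"
      where "y = (\<chi> i. (if i = ?s then x $ 1 else 0) + (if i = ?t then x $ 2 else 0))"
    have Wy: "(W *v y) $ i = W $ i $ ?s * x $ 1 + W $ i $ ?t * x $ 2" for i
      by (simp add: matrix_vector_mult_def y_def distrib_left sum.distrib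
          if_distrib[of "\<lambda>x. _ * x"] cong: if_cong)
    have By: "(branch_mat N k V *v x) $ 1 = (W *v y) $ ?s"
      "(branch_mat N k V *v x) $ 2 = (W *v y) $ ?t"
      unfolding Wy by (simp_all add: matrix_vector_mult_def sum_2 nth)
    have "(\<Sum>i\<in>UNIV. cnj (y $ i) * z i) = cnj (x $ 1) * z ?s + cnj (x $ 2) * z ?t" for z
      by (simp add: y_def distrib_right sum.distrib if_distrib[of cnj]
          if_distrib[of "\<lambda>x. x * _"] cong: if_cong)
    then have "(\<Sum>i\<in>UNIV. cnj (y $ i) * (W *v y) $ i)
        = (\<Sum>a\<in>UNIV. cnj (x $ a) * (branch_mat N k V *v x) $ a)"
      by (simp only: sum_2 By)
    then show ?thesis using assms(1) by (metis psd_def)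
  qed
  moreover have "hermitian (branch_mat N k V)"
    using assms(1) by (simp add: hermitian_iff nth psd_def)
  ultimately show ?thesis by (simp add: psd_def)
qed

text \<open>The rank-1 completion supplies the OPF-feasible point. The bound ranges over all psd
  \<open>W\<close>, not only over the matrices \<open>outer v\<close>, because strong duality is
  applied to the semidefinite relaxation.\<close>

lemma soc_exact_imp_opf_optimal:
  assumes ok: "grid_ok N" and "soc_exact N"
  obtains v p g d where "opf_feasible N v p g d"
    "\<And>W p' g' d'. psd W \<Longrightarrow> injections_ok N p' g' d' \<Longrightarrow> power_balance N W p' g' d' \<Longrightarrow>
      (\<And>m. m \<in> cons N \<Longrightarrow> con_lhs N W p' m \<le> con_bound N m) \<Longrightarrow> welfare N g' d' \<le> welfare N g d"
proof -
  obtain V p g d U where opt: "soc_optimal N V p g d" and U: "psd U" "rank U = 1"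
    and UV: "\<And>i j. (i, j) \<in> I_set N \<Longrightarrow> U $ i $ j = V $ i $ j"
    using assms(2) by (fastforce simp: soc_exact_def rank1_completable_def)
  obtain v where v: "U = outer v" using psd_rank_1_eq_outer U by blast
  have "opf_feasible N v p g d"
    using opt constraints_cong[OF ok UV]
    by (auto simp: soc_optimal_def soc_feasible_def opf_feasible_def v)
  moreover have "welfare N g' d' \<le> welfare N g d"
    if W: "psd W" and feas: "injections_ok N p' g' d'" "power_balance N W p' g' d'"
      "\<And>m. m \<in> cons N \<Longrightarrow> con_lhs N W p' m \<le> con_bound N m" for W p' g' d'
  proof -
    \<comment> \<open>Zeroing \<open>W\<close> off the pattern may destroy psd-ness of the whole
      matrix, but leaves the branch submatrices and the constraints unchanged.\<close>
    define V' where "V' = (\<chi> i j. if (i, j) \<in> I_set N then W $ i $ j else 0)"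
    have V'W: "V' $ i $ j = W $ i $ j" if "(i, j) \<in> I_set N" for i j
      using that by (simp add: V'_def)
    have "(j, i) \<in> I_set N" if "(i, j) \<in> I_set N" for i j
      using that by (auto simp: I_set_def)
    then have "V' \<in> sparse_hermitian N"
      using W by (auto simp: V'_def sparse_hermitian_def psd_def hermitian_iff)
    moreover have "psd (branch_mat N k V')" for k
      using W _ V'W by (rule psd_branch_mat) (use ok in \<open>auto simp: grid_ok_def\<close>)
    ultimately have "soc_feasible N V' p' g' d'"
      using feas constraints_cong[OF ok V'W] by (auto simp: soc_feasible_def)
    then show ?thesis using opt by (auto simp: soc_optimal_def)
  qed
  ultimately show thesis by (rule that)
qed

section \<open>Duality\<close>

definition mismatch ::
  "('v::finite, 'e::finite, 'd::finite) grid \<Rightarrow> complex^'v^'v \<Rightarrow> real^'d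
    \<Rightarrow> ('v \<Rightarrow> real^2) \<Rightarrow> ('v \<Rightarrow> real^2) \<Rightarrow> 'v \<Rightarrow> real^2" where
  "mismatch N W p g d n =
     vector [tr_prod (P_mat N n) W + h_vec N n \<bullet> p, tr_prod (Q_mat N n) W] - (g n - d n)"

lemma power_balance_iff_mismatch: "power_balance N W p g d \<longleftrightarrow> (\<forall>n. mismatch N W p g d n = 0)"
  by (simp add: power_balance_def mismatch_def vec_eq_iff forall_2)

lemma dual_vec_inner:
  "dual_vec N lam mu \<bullet> p = (\<Sum>n\<in>UNIV. lam n $ 1 * (h_vec N n \<bullet> p)) + (\<Sum>m\<in>cons N. mu m * (con_vec m \<bullet> p))"
  by (simp add: dual_vec_def inner_add_left inner_sum_left)

lemma tr_prod_dual_mat: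
  "tr_prod (dual_mat N lam mu) W =
     (\<Sum>n\<in>UNIV. lam n $ 1 * tr_prod (P_mat N n) W + lam n $ 2 * tr_prod (Q_mat N n) W)
     + (\<Sum>m\<in>cons N. mu m * tr_prod (con_mat N m) W)"
  by (simp add: dual_mat_def tr_prod_add_left tr_prod_scaleR_left tr_prod_sum_left)

text \<open>Regroups the multiplier terms of the Lagrangian by primal variable: \<open>W\<close>
  meets \<open>dual_mat\<close>, \<open>p\<close> meets \<open>dual_vec\<close>, and the injections
  meet the prices \<open>lam\<close>. Both directions of duality use it.\<close>

lemma lagrangian_identity:
  "(\<Sum>n\<in>UNIV. lam n \<bullet> mismatch N W p g d n)
     + (\<Sum>m\<in>cons N. mu m * (con_lhs N W p m - con_bound N m))
   = tr_prod (dual_mat N lam mu) W + dual_vec N lam mu \<bullet> p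
     - (\<Sum>n\<in>UNIV. lam n \<bullet> (g n - d n)) - (\<Sum>m\<in>cons N. mu m * con_bound N m)"
proof -
  have "lam n \<bullet> mismatch N W p g d n
      = lam n $ 1 * tr_prod (P_mat N n) W + lam n $ 2 * tr_prod (Q_mat N n) W
        + lam n $ 1 * (h_vec N n \<bullet> p) - lam n \<bullet> (g n - d n)" for n
    by (simp add: mismatch_def inner_vec_def sum_2 algebra_simps)
  moreover have "mu m * (con_lhs N W p m - con_bound N m)
      = mu m * tr_prod (con_mat N m) W + mu m * (con_vec m \<bullet> p) - mu m * con_bound N m" for m
    by (simp add: con_lhs_def algebra_simps)
  ultimately show ?thesis
    by (simp only: tr_prod_dual_mat dual_vec_inner sum.distrib sum_subtractf)
qed

text \<open>Decouples the buses: the suprema of the individual summands are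
  \<open>load_surplus\<close> and \<open>gen_surplus\<close>.\<close>

lemma welfare_plus_price_terms:
  "welfare N g d + (\<Sum>n\<in>UNIV. lam n \<bullet> (g n - d n))
   = (\<Sum>n\<in>UNIV. benefit N n (d n) - lam n \<bullet> d n) + (\<Sum>n\<in>UNIV. lam n \<bullet> g n - cost N n (g n))"
  by (simp add: welfare_def inner_diff_right sum_subtractf)

lemma weak_duality:
  assumes "opf_feasible N v p g d" and "dual_feasible N lam mu"
  shows "ereal (welfare N g d) \<le> dual_objective N lam mu"
proof -
  have inj: "injections_ok N p g d"
    and mis: "\<And>n. mismatch N (outer v) p g d n = 0"
    and con: "\<And>m. m \<in> cons N \<Longrightarrow> con_lhs N (outer v) p m \<le> con_bound N m"
    using assms(1) by (auto simp: opf_feasible_def power_balance_iff_mismatch)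
  have mu: "\<And>m. m \<in> cons N \<Longrightarrow> 0 \<le> mu m" and "dual_vec N lam mu = 0"
    and "0 \<le> tr_prod (dual_mat N lam mu) (outer v)"
    using assms(2) by (auto simp: dual_feasible_def psd_iff_tr_prod)
  moreover have "(\<Sum>m\<in>cons N. mu m * (con_lhs N (outer v) p m - con_bound N m)) \<le> 0"
    using mu con by (intro sum_nonpos mult_nonneg_nonpos) auto
  \<comment> \<open>In the identity the mismatch and \<open>dual_vec\<close> terms vanish, the
    constraint terms are nonpositive, and the trace term is nonnegative.\<close>
  ultimately have "0 \<le> (\<Sum>n\<in>UNIV. lam n \<bullet> (g n - d n)) + (\<Sum>m\<in>cons N. mu m * con_bound N m)"
    using lagrangian_identity[of lam N "outer v" p g d mu] by (simp add: mis)
  then have "ereal (welfare N g d) \<le> ereal (\<Sum>m\<in>cons N. mu m * con_bound N m)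
      + (\<Sum>n\<in>UNIV. ereal (benefit N n (d n) - lam n \<bullet> d n))
      + (\<Sum>n\<in>UNIV. ereal (lam n \<bullet> g n - cost N n (g n)))"
    using welfare_plus_price_terms[of N g d lam] by simp
  also have "\<dots> \<le> dual_objective N lam mu"
    unfolding dual_objective_def load_surplus_def gen_surplus_def
    using inj by (intro add_mono sum_mono SUP_upper order_refl) (auto simp: injections_ok_def)
  finally show ?thesis .
qed

lemma dual_objective_le:
  assumes ok: "grid_ok N"
    and le: "\<And>g d. (\<And>n. g n \<in> gen N n) \<Longrightarrow> (\<And>n. d n \<in> load N n) \<Longrightarrow>
      welfare N g d + (\<Sum>n\<in>UNIV. lam n \<bullet> (g n - d n)) + (\<Sum>m\<in>cons N. mu m * con_bound N m) \<le> c"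
  shows "dual_objective N lam mu \<le> ereal c"
proof -
  let ?b = "\<Sum>m\<in>cons N. mu m * con_bound N m"
  \<comment> \<open>Loads (\<open>Inl\<close>) and generators (\<open>Inr\<close>) share one index
    type, so a single use of \<open>sum_SUP_ereal_le\<close> treats all choices as
    independent.\<close>
  define F where "F = case_sum (\<lambda>n x. benefit N n x - lam n \<bullet> x) (\<lambda>n x. lam n \<bullet> x - cost N n x)"
  define A where "A = case_sum (load N) (gen N)"
  have split: "sum h UNIV = (\<Sum>n\<in>UNIV. h (Inl n)) + (\<Sum>n\<in>UNIV. h (Inr n))"
    for h :: "'a + 'a \<Rightarrow> 'x::comm_monoid_add"
    using sum.Plus[of UNIV UNIV h] by simp
  have "(\<Sum>i\<in>UNIV. SUP x\<in>A i. ereal (F i x)) \<le> ereal (c - ?b)"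
  proof (rule sum_SUP_ereal_le)
    show "A i \<noteq> {}" for i using ok by (cases i) (auto simp: A_def grid_ok_def)
    fix x assume x: "\<And>i. i \<in> UNIV \<Longrightarrow> x i \<in> A i"
    have "x (Inr n) \<in> gen N n" "x (Inl n) \<in> load N n" for n
      using x[of "Inr n"] x[of "Inl n"] by (auto simp: A_def)
    then have "welfare N (\<lambda>n. x (Inr n)) (\<lambda>n. x (Inl n))
        + (\<Sum>n\<in>UNIV. lam n \<bullet> (x (Inr n) - x (Inl n))) + ?b \<le> c"
      by (intro le)
    then show "(\<Sum>i\<in>UNIV. F i (x i)) \<le> c - ?b"
      unfolding welfare_plus_price_terms split by (simp add: F_def)
  qed simp
  then have "(\<Sum>n\<in>UNIV. load_surplus N n (lam n)) + (\<Sum>n\<in>UNIV. gen_surplus N n (lam n)) \<le> ereal (c - ?b)"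
    unfolding split by (simp add: A_def F_def load_surplus_def gen_surplus_def)
  then have "ereal ?b + ((\<Sum>n\<in>UNIV. load_surplus N n (lam n)) + (\<Sum>n\<in>UNIV. gen_surplus N n (lam n)))
      \<le> ereal ?b + ereal (c - ?b)"
    by (rule add_left_mono)
  then show ?thesis by (simp add: dual_objective_def add.assoc)
qed

section \<open>Strong duality for the semidefinite relaxation\<close>

text \<open>In \<open>lagrange_multipliers\<close> the index type of the constraints must be finite,
  as it indexes the slack vectors; finiteness of the set \<open>cons N\<close> does not provide
  that.\<close>

instance con :: (finite, finite, finite) finite
proof
  have UNIV_con: "(UNIV :: ('a, 'b, 'c) con set) = range VMax \<union> range VMin
     \<union> range ISrc \<union> range IDst \<union> range DropMin \<union> range DropMax
     \<union> range Angle \<union> range AngleMin \<union> range AngleMax \<union> range FlowMax \<union> range FlowMin"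
    (is "_ = ?R")
  proof (intro set_eqI iffI UNIV_I)
    show "x \<in> ?R" for x by (cases x) simp_all
  qed
  show "finite (UNIV :: ('a, 'b, 'c) con set)" unfolding UNIV_con by simp
qed

text \<open>Injections are vectors instead of functions here, so that the domain lies in a real vector
  space.\<close>

definition sdr_domain ::
  "('v::finite, 'e::finite, 'd::finite) grid
    \<Rightarrow> ((complex^'v^'v) \<times> (real^'d) \<times> ((real^2)^'v) \<times> ((real^2)^'v)) set" where
  "sdr_domain N = {(W, p, g, d). psd W \<and> injections_ok N p (($) g) (($) d)}"

lemma concave_on_welfare:
  assumes "grid_ok N"
  shows "concave_on (sdr_domain N) (\<lambda>(W, p, g, d). welfare N (($) g) (($) d))"
proof -
  have conv: "\<And>n. convex (gen N n)" "\<And>n. convex (load N n)"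
    and fn: "\<And>n. convex_on (gen N n) (cost N n)" "\<And>n. concave_on (load N n) (benefit N n)"
    using assms by (auto simp: grid_ok_def)
  have dc: "a *\<^sub>R p + b *\<^sub>R p' \<in> dc_space N" if "p \<in> dc_space N" "p' \<in> dc_space N" for a b p p'
    using that by (intro subspace_add subspace_scale subspace_dc_space)
  have "convex (sdr_domain N)"
    by (rule convexI)
      (auto simp: sdr_domain_def injections_ok_def dc intro!: psd_add psd_scaleR
          convexD[OF conv(1)] convexD[OF conv(2)])
  moreover have "a * welfare N (($) g) (($) d) + b * welfare N (($) g') (($) d')
      \<le> welfare N (($) (a *\<^sub>R g + b *\<^sub>R g')) (($) (a *\<^sub>R d + b *\<^sub>R d'))"
    if mem: "\<And>n. g $ n \<in> gen N n" "\<And>n. g' $ n \<in> gen N n"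
      "\<And>n. d $ n \<in> load N n" "\<And>n. d' $ n \<in> load N n"
      and ab: "0 \<le> a" "0 \<le> b" "a + b = 1" for a b g g' d d'
  proof -
    have "cost N n (a *\<^sub>R g $ n + b *\<^sub>R g' $ n) \<le> a * cost N n (g $ n) + b * cost N n (g' $ n)"
      and "a * benefit N n (d $ n) + b * benefit N n (d' $ n) \<le> benefit N n (a *\<^sub>R d $ n + b *\<^sub>R d' $ n)"
      for n
      using fn[of n] mem[of n] ab by (auto simp: convex_on_def concave_on_iff)
    then have "(\<Sum>n\<in>UNIV. cost N n (a *\<^sub>R g $ n + b *\<^sub>R g' $ n))
        \<le> (\<Sum>n\<in>UNIV. a * cost N n (g $ n) + b * cost N n (g' $ n))"
      and "(\<Sum>n\<in>UNIV. a * benefit N n (d $ n) + b * benefit N n (d' $ n))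
        \<le> (\<Sum>n\<in>UNIV. benefit N n (a *\<^sub>R d $ n + b *\<^sub>R d' $ n))"
      by (intro sum_mono; simp)+
    then show ?thesis
      by (simp add: welfare_def sum.distrib sum_distrib_left right_diff_distrib)
  qed
  ultimately show ?thesis
    unfolding concave_on_iff by (auto simp: sdr_domain_def injections_ok_def)
qed

lemma linear_mismatch: "linear (\<lambda>(W, p, g, d). \<chi> n. mismatch N W p (($) g) (($) d) n)"
  by (rule linearI)
    (auto simp: mismatch_def vec_eq_iff forall_2 linear_add[OF linear_tr_prod]
      linear_scale[OF linear_tr_prod] inner_add_right algebra_simps)

lemma convex_on_constraint:
  assumes "convex K"
  shows "convex_on K (\<lambda>(W, p, g, d). con_lhs N W p m - con_bound N m)"
proof -
  \<comment> \<open>The constraint function is affine, so convexity holds with equality once the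
    constant bound is split by the weights.\<close>
  have "b = u * b + v * b" if "u + v = 1" for u v b :: real
    using that by (metis distrib_right mult_1)
  then show ?thesis
    unfolding convex_on_def
    by (force simp: assms con_lhs_def linear_add[OF linear_tr_prod] linear_scale[OF linear_tr_prod]
        inner_add_right algebra_simps)
qed

text \<open>With \<open>outer v\<close> and \<open>p\<close> fixed, each bus can correct its own
  mismatch through its injections alone, so the neighbourhoods of the \<open>g n - d n\<close>
  combine to one of zero.\<close>

lemma zero_in_interior_mismatch:
  assumes "opf_feasible N v p g d"
    and int: "\<And>n. g n - d n \<in> interior {x - y |x y. x \<in> gen N n \<and> y \<in> load N n}"
  shows "0 \<in> interior ((\<lambda>(W, p, g, d). \<chi> n. mismatch N W p (($) g) (($) d) n) ` sdr_domain N)"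
proof (rule interiorI)
  let ?I = "\<lambda>n. interior {x - y |x y. x \<in> gen N n \<and> y \<in> load N n}"
  \<comment> \<open>Replacing the net injection by \<open>g n - d n - w $ n\<close> changes the
    mismatch at bus \<open>n\<close> from zero to \<open>w $ n\<close>.\<close>
  let ?T = "{w :: (real^2)^_. \<forall>n. g n - d n - w $ n \<in> ?I n}"
  have "open ((\<lambda>w :: (real^2)^_. g n - d n - w $ n) -` ?I n)" for n
    by (intro open_vimage open_interior continuous_intros)
  then have "open (\<Inter>n. (\<lambda>w :: (real^2)^_. g n - d n - w $ n) -` ?I n)" by (intro open_INT) auto
  also have "(\<Inter>n. (\<lambda>w :: (real^2)^_. g n - d n - w $ n) -` ?I n) = ?T" by auto
  finally show "open ?T" .
  show "0 \<in> ?T" using int by simp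
  show "?T \<subseteq> (\<lambda>(W, p, g, d). \<chi> n. mismatch N W p (($) g) (($) d) n) ` sdr_domain N"
  proof
    fix w assume "w \<in> ?T"
    then have "\<forall>n. \<exists>x y. g n - d n - w $ n = x - y \<and> x \<in> gen N n \<and> y \<in> load N n"
      using interior_subset by blast
    then obtain x y where xy: "\<And>n. g n - d n - w $ n = x n - y n"
      "\<And>n. x n \<in> gen N n" "\<And>n. y n \<in> load N n"
      by metis
    have "w $ n = mismatch N (outer v) p x y n" for n
    proof -
      have "mismatch N (outer v) p g d n = 0"
        using assms(1) by (simp add: opf_feasible_def power_balance_iff_mismatch)
      moreover have "mismatch N (outer v) p x y n = mismatch N (outer v) p g d n + (g n - d n) - (x n - y n)"
        by (simp add: mismatch_def)
      ultimately show ?thesis using xy(1)[of n] by (simp add: algebra_simps)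
    qed
    moreover have "(outer v, p, vec_lambda x, vec_lambda y) \<in> sdr_domain N"
      using assms(1) xy by (simp add: sdr_domain_def opf_feasible_def injections_ok_def psd_outer vec_lambda_inverse)
    ultimately show "w \<in> (\<lambda>(W, p, g, d). \<chi> n. mismatch N W p (($) g) (($) d) n) ` sdr_domain N"
      by (intro image_eqI[of _ _ "(outer v, p, vec_lambda x, vec_lambda y)"])
        (simp_all add: vec_lambda_inverse vec_eq_iff[of w])
  qed
qed

text \<open>The multiplier inequality holds for all psd \<open>W\<close> and all flows
  \<open>p\<close>. Scaling these without bound yields dual feasibility, and setting them to zero
  yields the bound on the dual objective.\<close>

lemma sdr_strong_duality:
  assumes ok: "grid_ok N" and sf: "strict_feasibility N"
    and opt: "\<And>W p g d. psd W \<Longrightarrow> injections_ok N p g d \<Longrightarrow> power_balance N W p g d \<Longrightarrow>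
      (\<And>m. m \<in> cons N \<Longrightarrow> con_lhs N W p m \<le> con_bound N m) \<Longrightarrow> welfare N g d \<le> c"
  obtains lam mu where "dual_feasible N lam mu" "dual_objective N lam mu \<le> ereal c"
proof -
  obtain v0 p0 g0 d0 where feas: "opf_feasible N v0 p0 g0 d0"
    and strict: "\<And>m. m \<in> cons N \<Longrightarrow> con_lhs N (outer v0) p0 m < con_bound N m"
    and int: "\<And>n. g0 n - d0 n \<in> interior {x - y |x y. x \<in> gen N n \<and> y \<in> load N n}"
    using sf by (auto simp: strict_feasibility_def)
  let ?x0 = "(outer v0, p0, vec_lambda g0, vec_lambda d0)"
  have K: "convex (sdr_domain N)" using concave_on_imp_convex concave_on_welfare[OF ok] .
  obtain l mu where mu: "\<And>m. m \<in> cons N \<Longrightarrow> 0 \<le> mu m"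
    and lag: "\<And>x. x \<in> sdr_domain N \<Longrightarrow> (\<lambda>(W, p, g, d). welfare N (($) g) (($) d)) x
      \<le> c + l \<bullet> (\<lambda>(W, p, g, d). \<chi> n. mismatch N W p (($) g) (($) d) n) x
        + (\<Sum>m\<in>cons N. mu m * (\<lambda>(W, p, g, d). con_lhs N W p m - con_bound N m) x)"
  proof (rule lagrange_multipliers[OF concave_on_welfare[OF ok] linear_mismatch[of N]
        convex_on_constraint[OF K, of N] _ zero_in_interior_mismatch[OF feas int],
        where xf = ?x0 and I = "cons N" and v = c])
    show "?x0 \<in> sdr_domain N"
      using feas by (simp add: sdr_domain_def opf_feasible_def psd_outer vec_lambda_inverse)
    show "(\<lambda>(W, p, g, d). \<chi> n. mismatch N W p (($) g) (($) d) n) ?x0 = 0"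
      using feas
      by (simp add: opf_feasible_def power_balance_iff_mismatch vec_eq_iff[of _ 0] vec_lambda_inverse)
    show "(\<lambda>(W, p, g, d). con_lhs N W p m - con_bound N m) ?x0 < 0" if "m \<in> cons N" for m
      using strict[OF that] by simp
    show "(\<lambda>(W, p, g, d). welfare N (($) g) (($) d)) x \<le> c"
      if "x \<in> sdr_domain N" "(\<lambda>(W, p, g, d). \<chi> n. mismatch N W p (($) g) (($) d) n) x = 0"
        "\<And>m. m \<in> cons N \<Longrightarrow> (\<lambda>(W, p, g, d). con_lhs N W p m - con_bound N m) x \<le> 0" for x
      using that opt by (cases x) (auto simp: sdr_domain_def power_balance_iff_mismatch vec_eq_iff)
  qed blast
  define lam where "lam = (($) l)"
  define b where "b = (\<Sum>m\<in>cons N. mu m * con_bound N m)"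
  have bound: "welfare N g d + (\<Sum>n\<in>UNIV. lam n \<bullet> (g n - d n)) + b
      \<le> c + tr_prod (dual_mat N lam mu) W + dual_vec N lam mu \<bullet> p"
    if "psd W" "injections_ok N p g d" for W p g d
  proof -
    have "welfare N g d \<le> c + (\<Sum>n\<in>UNIV. lam n \<bullet> mismatch N W p g d n)
        + (\<Sum>m\<in>cons N. mu m * (con_lhs N W p m - con_bound N m))"
      using lag[of "(W, p, vec_lambda g, vec_lambda d)"] that
      by (simp add: sdr_domain_def inner_vec_def[of l] lam_def mismatch_def vec_lambda_inverse)
    then show ?thesis using lagrangian_identity[of lam N W p g d mu] by (simp add: b_def)
  qed
  have inj: "injections_ok N p g0 d0" if "p \<in> dc_space N" for p
    using feas that by (simp add: opf_feasible_def injections_ok_def)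
  have zero: "tr_prod A 0 = 0" for A :: "complex^'a^'a" by (rule linear_0[OF linear_tr_prod])
  \<comment> \<open>The constant left over when \<open>bound\<close> is taken at the injections
    \<open>g0\<close>, \<open>d0\<close>; what remains varies linearly with \<open>W\<close> and
    \<open>p\<close>.\<close>
  define w where "w = c - (welfare N g0 d0 + (\<Sum>n\<in>UNIV. lam n \<bullet> (g0 n - d0 n)) + b)"
  have "0 \<le> tr_prod (dual_mat N lam mu) (outer x)" for x
  proof (rule nonneg_slopeI)
    fix s :: real assume "0 \<le> s"
    then show "0 \<le> w + s * tr_prod (dual_mat N lam mu) (outer x)"
      using bound[OF psd_scaleR[OF _ psd_outer[of x]] inj[OF subspace_0[OF subspace_dc_space]], of s]
      by (simp add: w_def linear_scale[OF linear_tr_prod])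
  qed
  then have "psd (dual_mat N lam mu)" by (simp add: psd_iff_tr_prod hermitian_dual_mat[OF ok])
  moreover have "dual_vec N lam mu = 0"
  proof -
    let ?y = "dual_vec N lam mu"
    \<comment> \<open>The flow moves in the direction opposite to \<open>dual_vec\<close>, where the
      slope is minus its squared norm.\<close>
    have "0 \<le> - (?y \<bullet> ?y)"
    proof (rule nonneg_slopeI)
      fix s :: real
      have "(- s) *\<^sub>R ?y \<in> dc_space N"
        by (intro subspace_scale subspace_dc_space dual_vec_dc_space ok)
      from bound[OF psd_0 inj[OF this]] show "0 \<le> w + s * - (?y \<bullet> ?y)"
        by (simp add: w_def zero)
    qed
    then show ?thesis by (metis inner_ge_zero inner_eq_zero_iff neg_0_le_iff_le order_antisym)
  qed
  ultimately have "dual_feasible N lam mu" using mu by (simp add: dual_feasible_def)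
  moreover have "dual_objective N lam mu \<le> ereal c"
  proof (rule dual_objective_le[OF ok])
    fix g d assume "\<And>n. g n \<in> gen N n" "\<And>n. d n \<in> load N n"
    then have "injections_ok N 0 g d"
      by (simp add: injections_ok_def subspace_0[OF subspace_dc_space])
    from bound[OF psd_0 this]
    show "welfare N g d + (\<Sum>n\<in>UNIV. lam n \<bullet> (g n - d n)) + (\<Sum>m\<in>cons N. mu m * con_bound N m) \<le> c"
      by (simp add: zero b_def)
  qed
  ultimately show thesis by (rule that)
qed

theorem theorem3:
  fixes N :: "('v::finite, 'e::finite, 'd::finite) grid"
  assumes "grid_ok N"
    and "strict_feasibility N"
    and "soc_exact N"
  shows "opf_value N = dual_value N"
proof (rule antisym)
  show "opf_value N \<le> dual_value N"
    unfolding opf_value_def dual_value_def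
    by (intro SUP_least INF_greatest) (auto intro: weak_duality)
  obtain v p g d where feas: "opf_feasible N v p g d"
    and opt: "\<And>W p' g' d'. psd W \<Longrightarrow> injections_ok N p' g' d' \<Longrightarrow> power_balance N W p' g' d' \<Longrightarrow>
      (\<And>m. m \<in> cons N \<Longrightarrow> con_lhs N W p' m \<le> con_bound N m) \<Longrightarrow> welfare N g' d' \<le> welfare N g d"
    using soc_exact_imp_opf_optimal[OF assms(1,3)] by blast
  \<comment> \<open>The welfare of an OPF-feasible point is itself a bound for the whole relaxation,
    so these multipliers close the gap.\<close>
  obtain lam mu where dual: "dual_feasible N lam mu" "dual_objective N lam mu \<le> ereal (welfare N g d)"
    by (rule sdr_strong_duality[OF assms(1,2), of "welfare N g d"]) (use opt in blast)+
  have "dual_value N \<le> dual_objective N lam mu"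
    unfolding dual_value_def using dual(1) by (intro INF_lower2[of "(lam, mu)"]) auto
  also note dual(2)
  also have "ereal (welfare N g d) \<le> opf_value N"
    unfolding opf_value_def using feas by (intro SUP_upper2[of "(v, p, g, d)"]) auto
  finally show "dual_value N \<le> opf_value N" .
qed

end
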